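(* A flat disunification problem $\Gamma_0$ (whose dissubsumptions have a single atom on the right-hand side) has a local solution iff there is a successful run of the goal-oriented algorithm below on $\Gamma_0$.
   Context: $\mathcal{EL}$ concept terms are built from concept names $N_C$ and role names $N_R$ using $C\sqcap D$, $\exists r.C$ and $\top$; $C\sqsubseteq D$ means $C^{\mathcal I}\subseteq D^{\mathcal I}$ in every interpretation. An atom is a concept name or existential restriction; flat if it is a concept name or $\exists r.A$ with $A$ a concept name. $N_C$ is partitioned into variables and constants; ground = no variables. A flat disunification problem is a finite set of subsumptions $C_1\sqcap\dots\sqcap C_n\sqsubseteq^? D$ and dissubsumptions $C_1\sqcap\dots\sqcap C_n\not\sqsubseteq^? D_1\sqcap\dots\sqcap D_m$ of flat atoms over a fixed finite signature; a solution is a substitution (variables to ground terms) satisfying $\sigma(C)\sqsubseteq\sigma(D)$ resp. $\sigma(C)\not\sqsubseteq\sigma(D)$. $\mathsf{At}$ = atoms occurring as subterms of $\Gamma_0$, $\mathsf{Var}$ = variables occurring, $\mathsf{At_{nv}}=\mathsf{At}\setminus\mathsf{Var}$. An assignment gives each variable $X$ a set $S_X\subseteq\mathsf{At_{nv}}$; $>_S$ is the transitive closure of $\{(X,Y)\mid Y\text{ occurs in an atom of }S_X\}$; $S$ is acyclic if $>_S$ is irreflexive, in which case $\sigma_S(X):=\sigma_S(D_1)\sqcap\dots\sqcap\sigma_S(D_k)$ for $S_X=\{D_1,\dots,D_k\}$ ($\top$ if empty), defined inductively along $>_S$. A local solution is a solution of the form $\sigma_S$ for an acyclic assignment $S$.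 Algorithm: maintain $\Gamma:=\Gamma_0$, assignment $S$ (initially all $S_X=\emptyset$), and a solved/unsolved mark per element. Subsumptions $C_1\sqcap\dots\sqcap C_n\sqsubseteq^? X$ and dissubsumptions $X\not\sqsubseteq^? D$ ($X$ a variable, $D$ a non-variable atom) are "initially solved"; all others start unsolved. Expanding $\Gamma$ w.r.t. $X$ adds $C_1\sqcap\dots\sqcap C_n\sqsubseteq^? E$ for every initially solved $C_1\sqcap\dots\sqcap C_n\sqsubseteq^? X$ and $E\in S_X$, and $E\not\sqsubseteq^? D$ for every $X\not\sqsubseteq^? D\in\Gamma$ and $E\in S_X$ (only if not present; new elements unsolved unless of initially solved form). Eager rules: (Eager Ground Solving) ground $C_1\sqcap\dots\sqcap C_n\bowtie^? D$, $\bowtie\in\{\sqsubseteq,\not\sqsubseteq\}$: mark solved if it holds, else fail. (Eager Solving) $C_1\sqcap\dots\sqcap C_n\bowtie^? D$ with some $C_i=D$ or $C_i$ a variable with $D\in S_{C_i}$: if $\bowtie$ is $\sqsubseteq$ mark solved, else fail. (Eager Extension) $C_1\sqcap\dots\sqcap C_n\sqsubseteq^? D$ with a variable $C_i$ and $\{C_1,\dots,C_n\}\setminus\{C_i\}\subseteq S_{C_i}$: add $D$ to $S_{C_i}$, fail if cyclic, else expand w.r.t. $C_i$ and mark solved. (Eager Top Solving) $C\not\sqsubseteq^?\top$: fail. (Eager Left Decomposition) $C_1\sqcap\dots\sqcap C_n\not\sqsubseteq^? D$, $n\ne1$, $D$ non-variable atom: mark solved, add $C_i\not\sqsubseteq^?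 D$ for each $i$, expanding w.r.t. $C_i$ if it is a variable. (Eager Atomic Decomposition) $C\not\sqsubseteq^? D$ for non-variable atoms: (a) both ground and $C\sqsubseteq D$: fail; (b) both ground and $C\not\sqsubseteq D$: mark solved; (c) $C$ or $D$ a constant: mark solved; (d) $\exists r.C'$ vs $\exists s.D'$, $r\ne s$: mark solved; (e) $\exists r.C'$ vs $\exists r.D'$: add $C'\not\sqsubseteq^? D'$, expand w.r.t. $C'$ if $C'$ is a variable and $D'$ is not, mark solved. Nondeterministic rules: (Decomposition) $C_1\sqcap\dots\sqcap C_n\sqsubseteq^?\exists s.D$ with some $C_i=\exists s.C$: choose $i$, add $C\sqsubseteq^? D$, expand w.r.t. $D$ if a variable, mark solved. (Extension) $C_1\sqcap\dots\sqcap C_n\sqsubseteq^? D$ with a variable $C_i$: choose $i$, add $D$ to $S_{C_i}$, fail if cyclic, else expand w.r.t. $C_i$ and mark solved. (Local Extension) $C\not\sqsubseteq^? X$, $X$ a variable: choose a non-variable atom $D$, add it to $S_X$, fail if cyclic, else add $C\not\sqsubseteq^? D$, expand w.r.t. $X$ (and w.r.t. $C$ if a variable), mark solved. Loop: while some element is unsolved, apply an eager rule to an unsolved element if possible (failure ⇒ return failure); otherwise pick an unsolved element and apply a nondeterministic rule to it (return failure if none applies or it fails). When all elements are solved, return $\sigma_S$. *)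

theory Defs
  imports Main
begin

section \<open>The description logic EL\<close>

text \<open>The set of concept names is partitioned into variables and constants.\<close>

datatype ('v, 'c) cname = Var 'v | Const 'c

datatype (cnames: 'n, roles: 'r) concept =
    Top
  | Name 'n
  | And "('n, 'r) concept" "('n, 'r) concept"
  | Ex 'r "('n, 'r) concept"

fun Conj :: "('n, 'r) concept list \<Rightarrow> ('n, 'r) concept" where
  "Conj [] = Top"
| "Conj [C] = C"
| "Conj (C # D # Es) = And C (Conj (D # Es))"

record ('d, 'n, 'r) interp =
  idom :: "'d set"
  iname :: "'n \<Rightarrow> 'd set"
  irole :: "'r \<Rightarrow> ('d \<times> 'd) set"

definition interpretation_on :: "('d, 'n, 'r) interp \<Rightarrow> bool" where
  "interpretation_on I \<longleftrightarrow> idom I \<noteq> {} \<and> (\<forall>A. iname I A \<subseteq> idom I) \<and>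
     (\<forall>r. irole I r \<subseteq> idom I \<times> idom I)"

fun ext :: "('d, 'n, 'r) interp \<Rightarrow> ('n, 'r) concept \<Rightarrow> 'd set" where
  "ext I Top = idom I"
| "ext I (Name A) = iname I A"
| "ext I (And C D) = ext I C \<inter> ext I D"
| "ext I (Ex r C) = {x \<in> idom I. \<exists>y. (x, y) \<in> irole I r \<and> y \<in> ext I C}"

text \<open>A definition cannot quantify over the type of domain elements. Nonempty subsets
  of the natural numbers suffice: lemma \<open>subsumed_all_domains\<close> below shows that the
  resulting relation is subsumption in all interpretations over all types.\<close>

definition subsumed :: "('n, 'r) concept \<Rightarrow> ('n, 'r) concept \<Rightarrow> bool"
    (infix \<open>\<sqsubseteq>\<^sub>c\<close> 50) where
  "C \<sqsubseteq>\<^sub>c D \<longleftrightarrow> (\<forall>I :: (nat, 'n, 'r) interp. interpretation_on I \<longrightarrow> ext I C \<subseteq> ext I D)"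

fun conjuncts :: "('n, 'r) concept \<Rightarrow> ('n, 'r) concept set" where
  "conjuncts (And C D) = conjuncts C \<union> conjuncts D"
| "conjuncts C = {C}"

fun subterms :: "('n, 'r) concept \<Rightarrow> ('n, 'r) concept set" where
  "subterms Top = {Top}"
| "subterms (Name A) = {Name A}"
| "subterms (And C D) = insert (And C D) (subterms C \<union> subterms D)"
| "subterms (Ex r C) = insert (Ex r C) (subterms C)"

lemma finite_subterms: "finite (subterms C)"
  by (induction C) auto

lemma self_subterm: "C \<in> subterms C"
  by (cases C) auto

lemma subterms_trans: "D \<in> subterms C \<Longrightarrow> subterms D \<subseteq> subterms C"
  by (induction C) auto

lemma conjuncts_subterms: "conjuncts C \<subseteq> subterms C"
  by (induction C) auto

lemma ext_conjuncts: "E \<in> conjuncts C \<Longrightarrow> ext I C \<subseteq> ext I E"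
  by (induction C) auto

lemma ext_idom: "interpretation_on I \<Longrightarrow> ext I C \<subseteq> idom I"
  by (induction C) (auto simp: interpretation_on_def)

lemma subsumed_all_domains:
  fixes I :: "('d, 'n, 'r) interp"
  assumes sub: "C \<sqsubseteq>\<^sub>c D" and I: "interpretation_on I"
  shows "ext I C \<subseteq> ext I D"
proof -
  define T where "T = subterms C"
  obtain f :: "('n, 'r) concept \<Rightarrow> nat" where inj: "inj_on f T"
    using finite_imp_inj_to_nat_seg[OF finite_subterms[of C]] unfolding T_def by blast
  define J :: "(nat, 'n, 'r) interp" where
    "J = \<lparr>idom = f ` T, iname = (\<lambda>A. f ` {E \<in> T. Name A \<in> conjuncts E}),
          irole = (\<lambda>r. {(f E, f F) | E F. E \<in> T \<and> F \<in> T \<and> Ex r F \<in> conjuncts E})\<rparr>"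
  have J: "interpretation_on J"
    using self_subterm[of C] by (auto simp: interpretation_on_def J_def T_def)
  have closed: "F \<in> T" if "E \<in> T" "Ex r F \<in> conjuncts E" for E F r
  proof -
    have "Ex r F \<in> T"
      using that conjuncts_subterms[of E] subterms_trans[of E C] by (auto simp: T_def)
    then have "subterms (Ex r F) \<subseteq> T" unfolding T_def by (rule subterms_trans)
    then show ?thesis using self_subterm[of F] by auto
  qed
  have holds: "f E \<in> ext J G" if "E \<in> T" "conjuncts G \<subseteq> conjuncts E" for E G
    using that
  proof (induction G arbitrary: E)
    case Top then show ?case by (auto simp: J_def)
  next
    case (Name A) then show ?case by (auto simp: J_def)
  next
    case (And G1 G2) then show ?case by auto
  next
    case (Ex r G)
    then have G: "G \<in> T" using closed by auto
    then have "f G \<in> ext J G" using Ex.IH[of G] by auto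
    moreover have "(f E, f G) \<in> irole J r" using Ex.prems G by (auto simp: J_def)
    ultimately show ?case using Ex.prems by (auto simp: J_def)
  qed
  have entails: "ext I E \<subseteq> ext I G" if "E \<in> T" "f E \<in> ext J G" for E G
    using that
  proof (induction G arbitrary: E)
    case Top then show ?case using ext_idom[OF I] by auto
  next
    case (Name A)
    then obtain E' where "E' \<in> T" "Name A \<in> conjuncts E'" "f E = f E'"
      by (auto simp: J_def)
    then have "Name A \<in> conjuncts E" using inj Name.prems by (metis inj_onD)
    then show ?case using ext_conjuncts by fastforce
  next
    case (And G1 G2) then show ?case by fastforce
  next
    case (Ex r G)
    then obtain E' F where EF: "E' \<in> T" "F \<in> T" "Ex r F \<in> conjuncts E'" "f E = f E'"
        "f F \<in> ext J G"
      by (auto simp: J_def)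
    then have "Ex r F \<in> conjuncts E" using inj Ex.prems by (metis inj_onD)
    then have "ext I E \<subseteq> ext I (Ex r F)" by (rule ext_conjuncts)
    moreover have "ext I F \<subseteq> ext I G" using Ex.IH EF by blast
    ultimately show ?case by fastforce
  qed
  have "f C \<in> ext J C" using holds[of C C] self_subterm[of C] by (auto simp: T_def)
  then have "f C \<in> ext J D" using sub J by (auto simp: subsumed_def)
  then show ?thesis using entails[of C D] self_subterm[of C] by (auto simp: T_def)
qed


section \<open>Flat disunification problems\<close>

datatype ('v, 'c, 'r) fatom = AName "('v, 'c) cname" | AEx 'r "('v, 'c) cname"

abbreviation AVar :: "'v \<Rightarrow> ('v, 'c, 'r) fatom" where
  "AVar X \<equiv> AName (Var X)"

fun term_of :: "('v, 'c, 'r) fatom \<Rightarrow> (('v, 'c) cname, 'r) concept" where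
  "term_of (AName A) = Name A"
| "term_of (AEx r A) = Ex r (Name A)"

abbreviation conj_of :: "('v, 'c, 'r) fatom list \<Rightarrow> (('v, 'c) cname, 'r) concept" where
  "conj_of Cs \<equiv> Conj (map term_of Cs)"

definition is_var :: "('v, 'c, 'r) fatom \<Rightarrow> bool" where
  "is_var C \<longleftrightarrow> (\<exists>X. C = AVar X)"

text \<open>\<open>Sub Cs D\<close> stands for the subsumption of the conjunction of Cs by D, \<open>Dis Cs Ds\<close>
  for the dissubsumption between the conjunctions of Cs and Ds; the empty list stands
  for the top concept.\<close>

datatype ('v, 'c, 'r) constr =
    Sub "('v, 'c, 'r) fatom list" "('v, 'c, 'r) fatom"
  | Dis "('v, 'c, 'r) fatom list" "('v, 'c, 'r) fatom list"

fun atoms_of :: "('v, 'c, 'r) constr \<Rightarrow> ('v, 'c, 'r) fatom set" where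
  "atoms_of (Sub Cs D) = insert D (set Cs)"
| "atoms_of (Dis Cs Ds) = set Cs \<union> set Ds"

fun subatoms :: "('v, 'c, 'r) fatom \<Rightarrow> ('v, 'c, 'r) fatom set" where
  "subatoms (AName A) = {AName A}"
| "subatoms (AEx r A) = {AEx r A, AName A}"

definition At :: "('v, 'c, 'r) constr set \<Rightarrow> ('v, 'c, 'r) fatom set" where
  "At \<Gamma> = (\<Union>e\<in>\<Gamma>. \<Union>C\<in>atoms_of e. subatoms C)"

definition At_nv :: "('v, 'c, 'r) constr set \<Rightarrow> ('v, 'c, 'r) fatom set" where
  "At_nv \<Gamma> = {D \<in> At \<Gamma>. \<not> is_var D}"

text \<open>A problem over the signature with concept names NC and role names NR.\<close>

definition flat_problem ::
  "('v, 'c) cname set \<Rightarrow> 'r set \<Rightarrow> ('v, 'c, 'r) constr set \<Rightarrow> bool" where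
  "flat_problem NC NR \<Gamma> \<longleftrightarrow> finite \<Gamma> \<and>
     (\<forall>C\<in>At \<Gamma>. cnames (term_of C) \<subseteq> NC \<and> roles (term_of C) \<subseteq> NR)"

definition ground :: "(('v, 'c) cname, 'r) concept \<Rightarrow> bool" where
  "ground C \<longleftrightarrow> (\<forall>X. Var X \<notin> cnames C)"

type_synonym ('v, 'c, 'r) subst = "'v \<Rightarrow> (('v, 'c) cname, 'r) concept"

fun subst :: "('v, 'c, 'r) subst \<Rightarrow> (('v, 'c) cname, 'r) concept
    \<Rightarrow> (('v, 'c) cname, 'r) concept" where
  "subst \<sigma> Top = Top"
| "subst \<sigma> (Name (Var X)) = \<sigma> X"
| "subst \<sigma> (Name (Const a)) = Name (Const a)"
| "subst \<sigma> (And C D) = And (subst \<sigma> C) (subst \<sigma> D)"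
| "subst \<sigma> (Ex r C) = Ex r (subst \<sigma> C)"

fun solves :: "('v, 'c, 'r) subst \<Rightarrow> ('v, 'c, 'r) constr \<Rightarrow> bool" where
  "solves \<sigma> (Sub Cs D) \<longleftrightarrow> subst \<sigma> (conj_of Cs) \<sqsubseteq>\<^sub>c subst \<sigma> (term_of D)"
| "solves \<sigma> (Dis Cs Ds) \<longleftrightarrow> \<not> subst \<sigma> (conj_of Cs) \<sqsubseteq>\<^sub>c subst \<sigma> (conj_of Ds)"

definition solution :: "('v, 'c) cname set \<Rightarrow> 'r set \<Rightarrow> ('v, 'c, 'r) constr set
    \<Rightarrow> ('v, 'c, 'r) subst \<Rightarrow> bool" where
  "solution NC NR \<Gamma> \<sigma> \<longleftrightarrow>
     (\<forall>X. ground (\<sigma> X) \<and> cnames (\<sigma> X) \<subseteq> NC \<and> roles (\<sigma> X) \<subseteq> NR) \<and>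
     (\<forall>e\<in>\<Gamma>. solves \<sigma> e)"


section \<open>Local solutions\<close>

type_synonym ('v, 'c, 'r) assign = "'v \<Rightarrow> ('v, 'c, 'r) fatom set"

definition assignment :: "('v, 'c, 'r) constr set \<Rightarrow> ('v, 'c, 'r) assign \<Rightarrow> bool" where
  "assignment \<Gamma> S \<longleftrightarrow> (\<forall>X. S X \<subseteq> At_nv \<Gamma>)"

definition dep :: "('v, 'c, 'r) assign \<Rightarrow> ('v \<times> 'v) set" where
  "dep S = {(X, Y). \<exists>D\<in>S X. Var Y \<in> cnames (term_of D)}"

text \<open>\<open>acyclic\<close> is the library's predicate: the transitive closure is irreflexive.\<close>

abbreviation acyclic_asg :: "('v, 'c, 'r) assign \<Rightarrow> bool" where
  "acyclic_asg S \<equiv> acyclic (dep S)"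

text \<open>Some enumeration of a finite set, fixing the otherwise unspecified order of the
  conjuncts of a substitution induced by an assignment.\<close>

definition enum_set :: "'a set \<Rightarrow> 'a list" where
  "enum_set A = (if finite A then SOME xs. set xs = A \<and> distinct xs else [])"

lemma enum_set: "finite A \<Longrightarrow> set (enum_set A) = A \<and> distinct (enum_set A)"
  unfolding enum_set_def
  using someI_ex[OF finite_distinct_list[of A]] by simp

lemma enum_set_subset: "x \<in> set (enum_set A) \<Longrightarrow> x \<in> A"
  using enum_set[of A] by (cases "finite A") (auto simp: enum_set_def)

lemma subst_cong [fundef_cong]:
  assumes "C = D" "\<And>X. Var X \<in> cnames D \<Longrightarrow> \<sigma> X = \<tau> X"
  shows "subst \<sigma> C = subst \<tau> D"
  using assms(2) unfolding assms(1)
proof (induction D)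
  case (Name A) then show ?case by (cases A) auto
qed auto

text \<open>The substitution induced by an acyclic assignment. The well-foundedness guard only
  makes the recursion total; it holds for all acyclic assignments, see
  \<open>sigma_acyclic\<close> below.\<close>

function sigma :: "('v, 'c, 'r) assign \<Rightarrow> ('v, 'c, 'r) subst" where
  "sigma S X = (if wf ((dep S)\<inverse>)
     then Conj (map (\<lambda>D. subst (\<lambda>Y. sigma S Y) (term_of D)) (enum_set (S X)))
     else Top)"
  by pat_completeness auto
termination
proof -
  define R where
    "R = {((S :: ('a, 'b, 'c) assign, Y), (S', X)). S = S' \<and> wf ((dep S)\<inverse>) \<and> (Y, X) \<in> (dep S)\<inverse>}"
  have "wf R"
    unfolding wf_def
  proof (intro allI impI)
    fix P and p :: "('a, 'b, 'c) assign \<times> 'a"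
    assume step: "\<forall>x. (\<forall>y. (y, x) \<in> R \<longrightarrow> P y) \<longrightarrow> P x"
    obtain S X where p: "p = (S, X)" by (cases p)
    show "P p"
    proof (cases "wf ((dep S)\<inverse>)")
      case True
      then have "P (S, X)"
      proof (induction X rule: wf_induct_rule)
        case (less X)
        have "P q" if "(q, (S, X)) \<in> R" for q
          using that less by (auto simp: R_def)
        then show ?case using step by blast
      qed
      then show ?thesis by (simp add: p)
    next
      case False
      then have "(q, p) \<notin> R" for q by (auto simp: R_def p)
      then show ?thesis using step by blast
    qed
  qed
  then show ?thesis
    by (relation R) (auto simp: R_def dep_def dest: enum_set_subset)
qed

declare sigma.simps [simp del]

lemma finite_At:
  fixes \<Gamma> :: "('v, 'c, 'r) constr set"
  assumes "finite \<Gamma>"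
  shows "finite (At \<Gamma>)"
proof -
  have "finite (subatoms C)" for C :: "('v, 'c, 'r) fatom" by (cases C) auto
  moreover have "finite (atoms_of e)" for e :: "('v, 'c, 'r) constr" by (cases e) auto
  ultimately show ?thesis using assms by (auto simp: At_def)
qed

lemma sigma_acyclic:
  fixes \<Gamma> :: "('v, 'c, 'r) constr set" and S :: "('v, 'c, 'r) assign"
  assumes fin: "finite \<Gamma>" and S: "assignment \<Gamma> S" and ac: "acyclic_asg S"
  shows "sigma S X = Conj (map (\<lambda>D. subst (sigma S) (term_of D)) (enum_set (S X)))"
    and "set (enum_set (S X)) = S X"
proof -
  have finA: "finite (At_nv \<Gamma>)" using finite_At[OF fin] by (simp add: At_nv_def)
  define V where "V = {Y. \<exists>D\<in>At_nv \<Gamma>. Var Y \<in> cnames (term_of D)}"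
  have "finite {Y. Var Y \<in> cnames (term_of D)}" for D :: "('v, 'c, 'r) fatom"
  proof (cases D)
    case (AName A) then show ?thesis by (cases A) auto
  next
    case (AEx r A) then show ?thesis by (cases A) auto
  qed
  moreover have "V = (\<Union>D\<in>At_nv \<Gamma>. {Y. Var Y \<in> cnames (term_of D)})"
    by (auto simp: V_def)
  ultimately have finV: "finite V" using finA by simp
  have dV: "Y \<in> V" if "(X, Y) \<in> dep S" for X Y
    using that S by (auto simp: V_def dep_def assignment_def)
  define d where "d = dep S \<inter> V \<times> V"
  have "finite d" using finV by (auto simp: d_def)
  moreover have "acyclic d" using ac by (rule acyclic_subset) (auto simp: d_def)
  ultimately have wfd: "wf (d\<inverse>)" by (rule finite_acyclic_wf_converse)
  have "wf ((dep S)\<inverse>)"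
    unfolding wf_def
  proof (intro allI impI)
    fix P x
    assume step: "\<forall>x. (\<forall>y. (y, x) \<in> (dep S)\<inverse> \<longrightarrow> P y) \<longrightarrow> P x"
    have *: "Y \<in> V \<longrightarrow> P Y" for Y
      using wfd
    proof (induction Y rule: wf_induct_rule)
      case (less Y)
      show ?case
      proof
        assume Y: "Y \<in> V"
        have "P Z" if "(Z, Y) \<in> (dep S)\<inverse>" for Z
          using that Y less dV by (auto simp: d_def)
        then show "P Y" using step by blast
      qed
    qed
    have "P Z" if "(Z, x) \<in> (dep S)\<inverse>" for Z
      using that * dV by auto
    then show "P x" using step by blast
  qed
  then show "sigma S X = Conj (map (\<lambda>D. subst (sigma S) (term_of D)) (enum_set (S X)))"
    by (subst sigma.simps) simp
  have "finite (S X)" using finA S by (auto simp: assignment_def intro: finite_subset)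
  then show "set (enum_set (S X)) = S X" using enum_set by blast
qed

definition local_solution :: "('v, 'c) cname set \<Rightarrow> 'r set \<Rightarrow> ('v, 'c, 'r) constr set
    \<Rightarrow> ('v, 'c, 'r) subst \<Rightarrow> bool" where
  "local_solution NC NR \<Gamma> \<sigma> \<longleftrightarrow> solution NC NR \<Gamma> \<sigma> \<and>
     (\<exists>S. assignment \<Gamma> S \<and> acyclic_asg S \<and> \<sigma> = sigma S)"


section \<open>The goal-oriented algorithm\<close>

record ('v, 'c, 'r) state =
  prob :: "('v, 'c, 'r) constr set"
  asg :: "('v, 'c, 'r) assign"
  solved :: "('v, 'c, 'r) constr set"

fun initially_solved :: "('v, 'c, 'r) constr \<Rightarrow> bool" where
  "initially_solved (Sub Cs D) \<longleftrightarrow> is_var D"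
| "initially_solved (Dis Cs Ds) \<longleftrightarrow> (\<exists>X D. Cs = [AVar X] \<and> Ds = [D] \<and> \<not> is_var D)"

definition init :: "('v, 'c, 'r) constr set \<Rightarrow> ('v, 'c, 'r) state" where
  "init \<Gamma> = \<lparr>prob = \<Gamma>, asg = (\<lambda>X. {}), solved = {e \<in> \<Gamma>. initially_solved e}\<rparr>"

definition unsolved :: "('v, 'c, 'r) state \<Rightarrow> ('v, 'c, 'r) constr set" where
  "unsolved st = prob st - solved st"

definition mark_solved ::
  "('v, 'c, 'r) constr \<Rightarrow> ('v, 'c, 'r) state \<Rightarrow> ('v, 'c, 'r) state" where
  "mark_solved e st = st\<lparr>solved := insert e (solved st)\<rparr>"

text \<open>Constraints that are already present keep their mark.\<close>

definition add_constrs ::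
  "('v, 'c, 'r) constr set \<Rightarrow> ('v, 'c, 'r) state \<Rightarrow> ('v, 'c, 'r) state" where
  "add_constrs N st = st\<lparr>prob := prob st \<union> N,
     solved := solved st \<union> {e \<in> N - prob st. initially_solved e}\<rparr>"

text \<open>Simultaneous expansion w.r.t. all variables in a set. Expansion never produces
  initially solved constraints from an assignment of non-variable atoms, so one round
  suffices.\<close>

definition expand :: "'v set \<Rightarrow> ('v, 'c, 'r) state \<Rightarrow> ('v, 'c, 'r) state" where
  "expand Xs st = add_constrs
     ({Sub Cs E | Cs X E. X \<in> Xs \<and> Sub Cs (AVar X) \<in> prob st \<and> E \<in> asg st X} \<union>
      {Dis [E] [D] | E X D. X \<in> Xs \<and> Dis [AVar X] [D] \<in> prob st \<and> \<not> is_var D \<and> E \<in> asg st X})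
     st"

definition add_to_asg ::
  "'v \<Rightarrow> ('v, 'c, 'r) fatom \<Rightarrow> ('v, 'c, 'r) state \<Rightarrow> ('v, 'c, 'r) state" where
  "add_to_asg X D st = st\<lparr>asg := (asg st)(X := insert D (asg st X))\<rparr>"

datatype ('v, 'c, 'r) outcome = Fail | Next "('v, 'c, 'r) state"

text \<open>The common action of Eager Extension and Extension.\<close>

definition extension_action :: "('v, 'c, 'r) constr \<Rightarrow> 'v \<Rightarrow> ('v, 'c, 'r) fatom
    \<Rightarrow> ('v, 'c, 'r) state \<Rightarrow> ('v, 'c, 'r) outcome" where
  "extension_action e X D st =
     (let st' = add_to_asg X D st in
      if acyclic_asg (asg st') then Next (mark_solved e (expand {X} st')) else Fail)"

text \<open>The cases of Eager Atomic Decomposition are tried in order. This is essential: a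
  ground dissubsumption between two equal constants must fail. The last case pattern
  covers non-variable atoms at least one of which is a constant.\<close>

definition atomic_action :: "('v, 'c, 'r) constr \<Rightarrow> ('v, 'c, 'r) fatom
    \<Rightarrow> ('v, 'c, 'r) fatom \<Rightarrow> ('v, 'c, 'r) state \<Rightarrow> ('v, 'c, 'r) outcome" where
  "atomic_action e C D st =
     (if ground (term_of C) \<and> ground (term_of D) then
        (if term_of C \<sqsubseteq>\<^sub>c term_of D then Fail else Next (mark_solved e st))
      else
        (case (C, D) of
           (AEx r C', AEx s D') \<Rightarrow>
             if r \<noteq> s then Next (mark_solved e st)
             else Next (mark_solved e
               (expand {X. C' = Var X \<and> (\<forall>Y. D' \<noteq> Var Y)}
                 (add_constrs {Dis [AName C'] [AName D']} st)))
         | _ \<Rightarrow> Next (mark_solved e st)))"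

inductive eager_rule :: "('v, 'c, 'r) state \<Rightarrow> ('v, 'c, 'r) constr
    \<Rightarrow> ('v, 'c, 'r) outcome \<Rightarrow> bool" for st where
  ground_solving_sub:
    "e = Sub Cs D \<Longrightarrow> ground (conj_of Cs) \<Longrightarrow> ground (term_of D) \<Longrightarrow>
     eager_rule st e
       (if conj_of Cs \<sqsubseteq>\<^sub>c term_of D then Next (mark_solved e st) else Fail)"
| ground_solving_dis:
    "e = Dis Cs [D] \<Longrightarrow> ground (conj_of Cs) \<Longrightarrow> ground (term_of D) \<Longrightarrow>
     eager_rule st e
       (if \<not> conj_of Cs \<sqsubseteq>\<^sub>c term_of D then Next (mark_solved e st) else Fail)"
| solving_sub:
    "e = Sub Cs D \<Longrightarrow> D \<in> set Cs \<or> (\<exists>X. AVar X \<in> set Cs \<and> D \<in> asg st X) \<Longrightarrow>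
     eager_rule st e (Next (mark_solved e st))"
| solving_dis:
    "e = Dis Cs [D] \<Longrightarrow> D \<in> set Cs \<or> (\<exists>X. AVar X \<in> set Cs \<and> D \<in> asg st X) \<Longrightarrow>
     eager_rule st e Fail"
| eager_extension:
    "e = Sub Cs D \<Longrightarrow> AVar X \<in> set Cs \<Longrightarrow> set Cs - {AVar X} \<subseteq> asg st X \<Longrightarrow>
     eager_rule st e (extension_action e X D st)"
| top_solving:
    "e = Dis Cs [] \<Longrightarrow> eager_rule st e Fail"
| left_decomposition:
    "e = Dis Cs [D] \<Longrightarrow> length Cs \<noteq> 1 \<Longrightarrow> \<not> is_var D \<Longrightarrow>
     eager_rule st e (Next (mark_solved e
       (expand {X. AVar X \<in> set Cs} (add_constrs {Dis [C] [D] | C. C \<in> set Cs} st))))"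
| atomic_decomposition:
    "e = Dis [C] [D] \<Longrightarrow> \<not> is_var C \<Longrightarrow> \<not> is_var D \<Longrightarrow>
     eager_rule st e (atomic_action e C D st)"

text \<open>The first argument is the input problem, whose non-variable atoms are the candidates
  in Local Extension.\<close>

inductive nondet_rule :: "('v, 'c, 'r) constr set \<Rightarrow> ('v, 'c, 'r) state
    \<Rightarrow> ('v, 'c, 'r) constr \<Rightarrow> ('v, 'c, 'r) outcome \<Rightarrow> bool" for \<Gamma>0 st where
  decomposition:
    "e = Sub Cs (AEx s D) \<Longrightarrow> AEx s C \<in> set Cs \<Longrightarrow>
     nondet_rule \<Gamma>0 st e (Next (mark_solved e
       (expand {X. D = Var X} (add_constrs {Sub [AName C] (AName D)} st))))"
| extension:
    "e = Sub Cs D \<Longrightarrow> AVar X \<in> set Cs \<Longrightarrow>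
     nondet_rule \<Gamma>0 st e (extension_action e X D st)"
| local_extension:
    "e = Dis Cs [AVar X] \<Longrightarrow> D \<in> At_nv \<Gamma>0 \<Longrightarrow> st' = add_to_asg X D st \<Longrightarrow>
     nondet_rule \<Gamma>0 st e
       (if acyclic_asg (asg st')
        then Next (mark_solved e
          (expand ({X} \<union> {Y. Cs = [AVar Y]}) (add_constrs {Dis Cs [D]} st')))
        else Fail)"

text \<open>One iteration of the main loop. Eager rules have priority over nondeterministic ones,
  and an eager rule that would fail counts as applicable.\<close>

inductive step :: "('v, 'c, 'r) constr set \<Rightarrow> ('v, 'c, 'r) state
    \<Rightarrow> ('v, 'c, 'r) outcome \<Rightarrow> bool" for \<Gamma>0 st where
  eager:
    "e \<in> unsolved st \<Longrightarrow> eager_rule st e res \<Longrightarrow> step \<Gamma>0 st res"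
| nondet:
    "\<not> (\<exists>e'\<in>unsolved st. \<exists>res'. eager_rule st e' res') \<Longrightarrow> e \<in> unsolved st \<Longrightarrow>
     nondet_rule \<Gamma>0 st e res \<Longrightarrow> step \<Gamma>0 st res"
| stuck:
    "\<not> (\<exists>e'\<in>unsolved st. \<exists>res'. eager_rule st e' res') \<Longrightarrow> e \<in> unsolved st \<Longrightarrow>
     \<not> (\<exists>res'. nondet_rule \<Gamma>0 st e res') \<Longrightarrow> step \<Gamma>0 st Fail"

datatype ('v, 'c, 'r) result = Failure | Success "('v, 'c, 'r) subst"

inductive run :: "('v, 'c, 'r) constr set \<Rightarrow> ('v, 'c, 'r) state
    \<Rightarrow> ('v, 'c, 'r) result \<Rightarrow> bool" for \<Gamma>0 where
  finished: "unsolved st = {} \<Longrightarrow> run \<Gamma>0 st (Success (sigma (asg st)))"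
| failed: "step \<Gamma>0 st Fail \<Longrightarrow> run \<Gamma>0 st Failure"
| continue: "step \<Gamma>0 st (Next st') \<Longrightarrow> run \<Gamma>0 st' res \<Longrightarrow> run \<Gamma>0 st res"

definition successful_run :: "('v, 'c, 'r) constr set \<Rightarrow> bool" where
  "successful_run \<Gamma>0 \<longleftrightarrow> (\<exists>\<sigma>. run \<Gamma>0 (init \<Gamma>0) (Success \<sigma>))"

end

theory Submission
  imports Defs
begin

text \<open>Soundness: in a final state every constraint holds either for all substitutions, or
  because of the assignment, or because of other constraints of the state. These reasons are
  well founded (the role depths decrease, and at equal depth variables are replaced by
  non-variable atoms), so the substitution induced by the final assignment solves every
  constraint.

  Completeness: a local solution \<open>\<gamma>\<close> guides the choices so that \<open>\<gamma>\<close> solves all constraints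
  of the state and \<open>\<gamma> X\<close> is subsumed by \<open>\<gamma> D\<close> whenever \<open>D\<close> is assigned to \<open>X\<close>. The latter
  makes the role depth of \<open>\<gamma>\<close> decrease along dependencies, so no rule fails by a cycle;
  locality provides the atom needed by Local Extension. Each step solves a new constraint
  from a fixed finite set.\<close>

section \<open>Subsumption\<close>

text \<open>The canonical interpretation of EL: its elements are the concepts themselves, and
  an element \<open>E\<close> belongs to the extension of \<open>G\<close> only if \<open>E\<close> is subsumed by \<open>G\<close>.\<close>

definition canonical :: "(('n, 'r) concept, 'n, 'r) interp" where
  "canonical = \<lparr>idom = UNIV, iname = (\<lambda>A. {E. Name A \<in> conjuncts E}),
     irole = (\<lambda>r. {(E, F). Ex r F \<in> conjuncts E})\<rparr>"

lemma interpretation_canonical: "interpretation_on canonical"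
  by (auto simp: interpretation_on_def canonical_def)

text \<open>In the existential case the filler \<open>G\<close> itself is the witnessing successor,
  and the induction hypothesis is used at \<open>E = G\<close>.\<close>

lemma canonical_conjuncts: "conjuncts G \<subseteq> conjuncts E \<Longrightarrow> E \<in> ext canonical G"
proof (induction G arbitrary: E)
  case (Ex r G)
  then show ?case by (auto simp: canonical_def)
qed (auto simp: canonical_def)

lemma subsumed_refl: "C \<sqsubseteq>\<^sub>c C"
  by (simp add: subsumed_def)

lemma subsumed_trans: "C \<sqsubseteq>\<^sub>c D \<Longrightarrow> D \<sqsubseteq>\<^sub>c E \<Longrightarrow> C \<sqsubseteq>\<^sub>c E"
  by (auto simp: subsumed_def)

lemma subsumed_Top: "C \<sqsubseteq>\<^sub>c Top"
  using ext_idom by (auto simp: subsumed_def)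

lemma subsumed_And_iff: "C \<sqsubseteq>\<^sub>c And D E \<longleftrightarrow> C \<sqsubseteq>\<^sub>c D \<and> C \<sqsubseteq>\<^sub>c E"
  by (auto simp: subsumed_def)

lemma subsumed_conjunct: "E \<in> conjuncts C \<Longrightarrow> C \<sqsubseteq>\<^sub>c E"
  by (simp add: subsumed_def ext_conjuncts)

lemma subsumed_ExI: "C \<sqsubseteq>\<^sub>c D \<Longrightarrow> Ex r C \<sqsubseteq>\<^sub>c Ex r D"
  unfolding subsumed_def by fastforce

lemma canonical_subsumed: "E \<in> ext canonical G \<Longrightarrow> E \<sqsubseteq>\<^sub>c G"
proof (induction G arbitrary: E)
  case Top
  show ?case by (rule subsumed_Top)
next
  case (Name A)
  then show ?case by (intro subsumed_conjunct) (simp add: canonical_def)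
next
  case (And G1 G2)
  then show ?case by (simp add: subsumed_And_iff)
next
  case (Ex r G)
  then obtain F where "Ex r F \<in> conjuncts E" "F \<sqsubseteq>\<^sub>c G"
    by (auto simp: canonical_def)
  then show ?case by (meson subsumed_ExI subsumed_conjunct subsumed_trans)
qed

text \<open>\<open>subsumed\<close> speaks of domains inside \<open>nat\<close>, whereas the
  elements of \<open>canonical\<close> are concepts; \<open>subsumed_all_domains\<close> bridges the
  two. Since \<open>C\<close> lies in its own extension, it lies in that of each subsumer.\<close>

lemma subsumed_iff_canonical: "C \<sqsubseteq>\<^sub>c D \<longleftrightarrow> C \<in> ext canonical D"
  using subsumed_all_domains[OF _ interpretation_canonical] canonical_conjuncts[of C C]
    canonical_subsumed by blast

text \<open>Membership in the canonical interpretation unfolds syntactically. This and the next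
  lemma replace reasoning about interpretations from here on.\<close>

lemma subsumed_Name_iff: "C \<sqsubseteq>\<^sub>c Name A \<longleftrightarrow> Name A \<in> conjuncts C"
  by (simp add: subsumed_iff_canonical canonical_def)

lemma subsumed_Ex_iff: "C \<sqsubseteq>\<^sub>c Ex r D \<longleftrightarrow> (\<exists>F. Ex r F \<in> conjuncts C \<and> F \<sqsubseteq>\<^sub>c D)"
  by (auto simp: subsumed_iff_canonical canonical_def)

section \<open>Conjunctions, role depth and instances of flat atoms\<close>

lemma subsumed_Conj_iff: "C \<sqsubseteq>\<^sub>c Conj Ds \<longleftrightarrow> (\<forall>D\<in>set Ds. C \<sqsubseteq>\<^sub>c D)"
  by (induction Ds rule: Conj.induct) (auto simp: subsumed_Top subsumed_And_iff)

lemma Conj_subsumed_member: "C \<in> set Cs \<Longrightarrow> Conj Cs \<sqsubseteq>\<^sub>c C"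
  using subsumed_Conj_iff subsumed_refl by blast

lemma conjuncts_Conj:
  "conjuncts (Conj Cs) = (if Cs = [] then {Top} else \<Union> (conjuncts ` set Cs))"
  by (induction Cs rule: Conj.induct) auto

lemma subst_Conj: "subst \<sigma> (Conj Cs) = Conj (map (subst \<sigma>) Cs)"
  by (induction Cs rule: Conj.induct) auto

lemma subst_ground: "ground C \<Longrightarrow> subst \<sigma> C = C"
proof (induction C)
  case (Name A)
  then show ?case by (cases A) (auto simp: ground_def)
qed (auto simp: ground_def)

fun role_depth :: "('n, 'r) concept \<Rightarrow> nat" where
  "role_depth Top = 0"
| "role_depth (Name A) = 0"
| "role_depth (And C D) = max (role_depth C) (role_depth D)"
| "role_depth (Ex r C) = Suc (role_depth C)"

lemma role_depth_conjunct: "E \<in> conjuncts C \<Longrightarrow> role_depth E \<le> role_depth C"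
  by (induction C) (auto simp: le_max_iff_disj)

lemma role_depth_antimono: "C \<sqsubseteq>\<^sub>c D \<Longrightarrow> role_depth D \<le> role_depth C"
proof (induction D arbitrary: C)
  case (Ex r D)
  then show ?case
    by (metis (no_types, lifting) Suc_le_mono le_trans role_depth.simps(4) role_depth_conjunct
        subsumed_Ex_iff)
qed (auto simp: subsumed_And_iff)

abbreviation inst :: "('v, 'c, 'r) subst \<Rightarrow> ('v, 'c, 'r) fatom
    \<Rightarrow> (('v, 'c) cname, 'r) concept" where
  "inst \<sigma> C \<equiv> subst \<sigma> (term_of C)"

lemma solves_Sub: "solves \<sigma> (Sub Cs D) \<longleftrightarrow> Conj (map (inst \<sigma>) Cs) \<sqsubseteq>\<^sub>c inst \<sigma> D"
  by (simp add: subst_Conj comp_def)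

lemma solves_Dis1: "solves \<sigma> (Dis Cs [D]) \<longleftrightarrow> \<not> Conj (map (inst \<sigma>) Cs) \<sqsubseteq>\<^sub>c inst \<sigma> D"
  by (simp add: subst_Conj comp_def)

declare solves.simps [simp del]

lemma nonvar_cases:
  assumes "\<not> is_var D"
  obtains a where "D = AName (Const a)" | r A where "D = AEx r A"
proof (cases D)
  case (AName A)
  with assms that show ?thesis by (cases A) (auto simp: is_var_def)
qed (use that in blast)

text \<open>The instance of a non-variable atom is again a name or an existential restriction, hence
  matched by a single conjunct. The instance of a variable may be a conjunction whose parts are
  matched by different conjuncts.\<close>

lemma Conj_subsumed_nonvar:
  assumes "\<not> is_var D"
  shows "Conj Cs \<sqsubseteq>\<^sub>c inst \<sigma> D \<longleftrightarrow> (\<exists>C\<in>set Cs. C \<sqsubseteq>\<^sub>c inst \<sigma> D)"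
  using assms
  by (cases rule: nonvar_cases) (auto simp: subsumed_Name_iff subsumed_Ex_iff conjuncts_Conj)

lemma solves_Sub_nonvar:
  "\<not> is_var D \<Longrightarrow> solves \<sigma> (Sub Cs D) \<longleftrightarrow> (\<exists>C\<in>set Cs. inst \<sigma> C \<sqsubseteq>\<^sub>c inst \<sigma> D)"
  by (simp add: solves_Sub Conj_subsumed_nonvar)

lemma solves_Dis_nonvar:
  "\<not> is_var D \<Longrightarrow> solves \<sigma> (Dis Cs [D]) \<longleftrightarrow> (\<forall>C\<in>set Cs. \<not> inst \<sigma> C \<sqsubseteq>\<^sub>c inst \<sigma> D)"
  by (simp add: solves_Dis1 Conj_subsumed_nonvar)

lemma inst_Ex_subsumed_iff:
  "inst \<sigma> (AEx r C) \<sqsubseteq>\<^sub>c inst \<sigma> (AEx s D) \<longleftrightarrow> r = s \<and> inst \<sigma> (AName C) \<sqsubseteq>\<^sub>c inst \<sigma> (AName D)"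
  by (auto simp: subsumed_Ex_iff)


section \<open>Invariants of the algorithm\<close>

fun lhs :: "('v, 'c, 'r) constr \<Rightarrow> ('v, 'c, 'r) fatom list" where
  "lhs (Sub Cs D) = Cs"
| "lhs (Dis Cs Ds) = Cs"

text \<open>Rules never build new conjunctions: a new constraint either keeps an existing left-hand
  side or has a single atom there.\<close>

definition lhs_lists :: "('v, 'c, 'r) constr set \<Rightarrow> ('v, 'c, 'r) fatom list set" where
  "lhs_lists \<Gamma> = lhs ` \<Gamma> \<union> (\<lambda>C. [C]) ` At \<Gamma>"

text \<open>A finite superset of the constraints that can occur in a run on \<open>\<Gamma>\<close>.\<close>

definition universe :: "('v, 'c, 'r) constr set \<Rightarrow> ('v, 'c, 'r) constr set" where
  "universe \<Gamma> = (\<lambda>(Cs, D). Sub Cs D) ` (lhs_lists \<Gamma> \<times> At \<Gamma>) \<union>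
     (\<lambda>(Cs, D). Dis Cs [D]) ` (lhs_lists \<Gamma> \<times> At \<Gamma>)"

lemma finite_universe: "finite \<Gamma> \<Longrightarrow> finite (universe \<Gamma>)"
  using finite_At by (auto simp: universe_def lhs_lists_def)

lemma Sub_universe: "Sub Cs D \<in> universe \<Gamma> \<longleftrightarrow> Cs \<in> lhs_lists \<Gamma> \<and> D \<in> At \<Gamma>"
  by (auto simp: universe_def)

lemma Dis_universe:
  "Dis Cs Ds \<in> universe \<Gamma> \<longleftrightarrow> Cs \<in> lhs_lists \<Gamma> \<and> (\<exists>D\<in>At \<Gamma>. Ds = [D])"
  by (auto simp: universe_def)

lemma subatoms_self: "C \<in> subatoms C"
  by (cases C) auto

lemma lhs_atoms: "set (lhs e) \<subseteq> atoms_of e"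
  by (cases e) auto

lemma atoms_At: "e \<in> \<Gamma> \<Longrightarrow> atoms_of e \<subseteq> At \<Gamma>"
  using subatoms_self by (fastforce simp: At_def)

lemma lhs_lists_At: "Cs \<in> lhs_lists \<Gamma> \<Longrightarrow> set Cs \<subseteq> At \<Gamma>"
  using lhs_atoms atoms_At by (fastforce simp: lhs_lists_def)

lemma singleton_lhs_lists: "C \<in> At \<Gamma> \<Longrightarrow> [C] \<in> lhs_lists \<Gamma>"
  by (simp add: lhs_lists_def)

lemma At_filler:
  assumes "AEx r A \<in> At \<Gamma>"
  shows "AName A \<in> At \<Gamma>"
proof -
  obtain e C where "e \<in> \<Gamma>" "C \<in> atoms_of e" "AEx r A \<in> subatoms C"
    using assms by (auto simp: At_def)
  moreover from this(3) have "AName A \<in> subatoms C" by (cases C) auto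
  ultimately show ?thesis by (auto simp: At_def)
qed

text \<open>The restriction to one atom on the right of dissubsumptions enters here. It keeps the
  empty right-hand side, on which Eager Top Solving fails, out of every state.\<close>

lemma problem_subset_universe:
  assumes "\<forall>Cs Ds. Dis Cs Ds \<in> \<Gamma> \<longrightarrow> length Ds = 1"
  shows "\<Gamma> \<subseteq> universe \<Gamma>"
proof
  fix e assume e: "e \<in> \<Gamma>"
  then have l: "lhs e \<in> lhs_lists \<Gamma>" by (simp add: lhs_lists_def)
  show "e \<in> universe \<Gamma>"
  proof (cases e)
    case (Sub Cs D)
    then show ?thesis using l atoms_At[OF e] by (simp add: Sub_universe)
  next
    case (Dis Cs Ds)
    then obtain D where "Ds = [D]"
      using assms e by (metis One_nat_def length_0_conv length_Suc_conv)
    then show ?thesis using l Dis atoms_At[OF e] by (simp add: Dis_universe)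
  qed
qed

text \<open>Why a constraint marked as solved holds, in terms of the assignment and of other
  constraints that must hold. The reasons persist when the state grows.\<close>

fun justified :: "('v, 'c, 'r) state \<Rightarrow> ('v, 'c, 'r) constr \<Rightarrow> bool" where
  "justified st (Sub Cs D) \<longleftrightarrow> is_var D \<or> (\<forall>\<sigma>. solves \<sigma> (Sub Cs D)) \<or>
     (\<exists>X. AVar X \<in> set Cs \<and> D \<in> asg st X) \<or>
     (\<exists>s C D'. D = AEx s D' \<and> AEx s C \<in> set Cs \<and> Sub [AName C] (AName D') \<in> prob st)"
| "justified st (Dis Cs Ds) \<longleftrightarrow> (\<forall>\<sigma>. solves \<sigma> (Dis Cs Ds)) \<or>
     (\<exists>X D. Cs = [AVar X] \<and> Ds = [D] \<and> \<not> is_var D) \<or>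
     (\<exists>D. Ds = [D] \<and> \<not> is_var D \<and> length Cs \<noteq> 1 \<and> (\<forall>C\<in>set Cs. Dis [C] [D] \<in> prob st)) \<or>
     (\<exists>r C D. Cs = [AEx r C] \<and> Ds = [AEx r D] \<and> Dis [AName C] [AName D] \<in> prob st) \<or>
     (\<exists>X D. Ds = [AVar X] \<and> D \<in> asg st X \<and> Dis Cs [D] \<in> prob st)"

text \<open>\<open>prob\<close> and \<open>asg\<close> occur only positively in a
  justification.\<close>

lemma justified_mono:
  assumes "justified st e" "prob st \<subseteq> prob st'" "\<And>X. asg st X \<subseteq> asg st' X"
  shows "justified st' e"
proof (cases e)
  case (Sub Cs D)
  show ?thesis using assms unfolding Sub justified.simps by blast
next
  case (Dis Cs Ds)
  show ?thesis using assms unfolding Dis justified.simps by blast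
qed

lemma initially_solved_justified: "initially_solved e \<Longrightarrow> justified st e"
  by (cases e) auto

text \<open>No rule ever treats the initially solved constraints; closure under expansion is what
  makes them true in the end.\<close>

definition expanded :: "('v, 'c, 'r) state \<Rightarrow> bool" where
  "expanded st \<longleftrightarrow>
     (\<forall>Cs X. \<forall>E\<in>asg st X. Sub Cs (AVar X) \<in> prob st \<longrightarrow> Sub Cs E \<in> prob st) \<and>
     (\<forall>X D. \<forall>E\<in>asg st X. Dis [AVar X] [D] \<in> prob st \<and> \<not> is_var D \<longrightarrow> Dis [E] [D] \<in> prob st)"

text \<open>Keeping initially solved constraints marked means that an unsolved subsumption has a
  non-variable atom on the right, so Extension assigns only such atoms.\<close>

definition invariant :: "('v, 'c, 'r) constr set \<Rightarrow> ('v, 'c, 'r) state \<Rightarrow> bool" where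
  "invariant \<Gamma> st \<longleftrightarrow> \<Gamma> \<subseteq> prob st \<and> prob st \<subseteq> universe \<Gamma> \<and>
     assignment \<Gamma> (asg st) \<and> acyclic_asg (asg st) \<and>
     (\<forall>e\<in>prob st. initially_solved e \<longrightarrow> e \<in> solved st) \<and>
     (\<forall>e\<in>solved st. justified st e) \<and> expanded st"

lemma invariant_init:
  assumes "\<forall>Cs Ds. Dis Cs Ds \<in> \<Gamma> \<longrightarrow> length Ds = 1"
  shows "invariant \<Gamma> (init \<Gamma>)"
  using problem_subset_universe[OF assms] initially_solved_justified
  by (auto simp: invariant_def init_def assignment_def expanded_def dep_def acyclic_def)

text \<open>Every rule application that does not fail yields a state of this form.\<close>

definition update :: "('v, 'c, 'r) constr \<Rightarrow> 'v set \<Rightarrow> ('v, 'c, 'r) constr set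
    \<Rightarrow> ('v, 'c, 'r) assign \<Rightarrow> ('v, 'c, 'r) state \<Rightarrow> ('v, 'c, 'r) state" where
  "update e Xs N A st = mark_solved e (expand Xs (add_constrs N (st\<lparr>asg := A\<rparr>)))"

lemma mark_solved_update: "mark_solved e st = update e {} {} (asg st) st"
  by (simp add: update_def expand_def add_constrs_def mark_solved_def)

lemma expand_add_update:
  "mark_solved e (expand Xs (add_constrs N st)) = update e Xs N (asg st) st"
  by (simp add: update_def)

lemma expand_add_to_asg_update:
  "mark_solved e (expand Xs (add_to_asg X D st)) =
     update e Xs {} ((asg st)(X := insert D (asg st X))) st"
  "mark_solved e (expand Xs (add_constrs N (add_to_asg X D st))) =
     update e Xs N ((asg st)(X := insert D (asg st X))) st"
  by (simp_all add: update_def add_constrs_def add_to_asg_def)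

lemma asg_add_to_asg: "asg (add_to_asg X D st) = (asg st)(X := insert D (asg st X))"
  by (simp add: add_to_asg_def)

lemma asg_update [simp]: "asg (update e Xs N A st) = A"
  by (simp add: update_def mark_solved_def expand_def add_constrs_def)

lemma prob_update:
  "prob (update e Xs N A st) = prob st \<union> N \<union>
     {Sub Cs E | Cs X E. X \<in> Xs \<and> Sub Cs (AVar X) \<in> prob st \<union> N \<and> E \<in> A X} \<union>
     {Dis [E] [D] | E X D. X \<in> Xs \<and> Dis [AVar X] [D] \<in> prob st \<union> N \<and> \<not> is_var D \<and> E \<in> A X}"
  by (simp add: update_def mark_solved_def expand_def add_constrs_def Un_assoc)

lemma solved_update:
  "insert e (solved st) \<subseteq> solved (update e Xs N A st)"
  "e' \<in> solved (update e Xs N A st) \<Longrightarrow> e' = e \<or> e' \<in> solved st \<or> initially_solved e'"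
  "\<lbrakk>e' \<in> prob (update e Xs N A st); e' \<notin> prob st; initially_solved e'\<rbrakk> \<Longrightarrow>
   e' \<in> solved (update e Xs N A st)"
  by (auto simp: update_def mark_solved_def expand_def add_constrs_def)

text \<open>The frame conditions say that a variable outside \<open>Xs\<close> receives neither a
  new atom nor a new constraint to which expansion reacts. Expanding the variables in
  \<open>Xs\<close> therefore restores \<open>expanded\<close>.\<close>

lemma invariant_update:
  assumes inv: "invariant \<Gamma> st" and N: "N \<subseteq> universe \<Gamma>"
    and mono: "\<And>X. asg st X \<subseteq> A X" and A: "assignment \<Gamma> A" and acyc: "acyclic_asg A"
    and frame: "\<And>X. X \<notin> Xs \<Longrightarrow> A X = asg st X"
      "\<And>X Cs. X \<notin> Xs \<Longrightarrow> Sub Cs (AVar X) \<notin> N"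
      "\<And>X D. X \<notin> Xs \<Longrightarrow> \<not> is_var D \<Longrightarrow> Dis [AVar X] [D] \<notin> N"
    and just: "justified (update e Xs N A st) e"
  shows "invariant \<Gamma> (update e Xs N A st)"
proof -
  let ?st = "update e Xs N A st"
  have nonvar: "E \<in> At \<Gamma>" "\<not> is_var E" if "E \<in> A X" for E X
    using A that by (auto simp: assignment_def At_nv_def)
  \<comment> \<open>Constraints produced by expansion are thus not themselves subject to expansion;
    those that are already lie in \<open>prob st \<union> N\<close>.\<close>
  then have no_var: "AVar Y \<notin> A X" for X Y unfolding is_var_def by metis
  have "prob st \<union> N \<subseteq> universe \<Gamma>" using N inv by (simp add: invariant_def)
  then have "prob ?st \<subseteq> universe \<Gamma>"
    using nonvar(1) singleton_lhs_lists
    by (fastforce simp: prob_update Sub_universe Dis_universe)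
  moreover have "\<Gamma> \<subseteq> prob ?st" using inv by (auto simp: invariant_def prob_update)
  moreover have "\<forall>e'\<in>prob ?st. initially_solved e' \<longrightarrow> e' \<in> solved ?st"
    using inv solved_update(1)[of e st Xs N A] solved_update(3)[of _ e Xs N A st]
    unfolding invariant_def by blast
  moreover have "justified ?st e'" if "e' \<in> solved ?st" for e'
  proof -
    have "justified ?st e'" if "justified st e'"
      using that by (rule justified_mono) (use mono in \<open>auto simp: prob_update\<close>)
    then show ?thesis
      using solved_update(2)[OF that] just inv initially_solved_justified
      by (auto simp: invariant_def)
  qed
  moreover have "expanded ?st"
    unfolding expanded_def asg_update
  proof (intro conjI allI ballI impI)
    fix Cs X E
    assume E: "E \<in> A X" and "Sub Cs (AVar X) \<in> prob ?st"
    then have *: "Sub Cs (AVar X) \<in> prob st \<union> N"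
      using no_var by (auto simp: prob_update)
    show "Sub Cs E \<in> prob ?st"
    proof (cases "X \<in> Xs")
      case True
      then show ?thesis using * E by (auto simp: prob_update)
    next
      case False
      then have "E \<in> asg st X" "Sub Cs (AVar X) \<in> prob st" using frame * E by auto
      then show ?thesis using inv by (auto simp: invariant_def expanded_def prob_update)
    qed
  next
    fix X D E
    assume E: "E \<in> A X" and "Dis [AVar X] [D] \<in> prob ?st \<and> \<not> is_var D"
    then have *: "Dis [AVar X] [D] \<in> prob st \<union> N" "\<not> is_var D"
      using no_var by (auto simp: prob_update)
    show "Dis [E] [D] \<in> prob ?st"
    proof (cases "X \<in> Xs")
      case True
      then show ?thesis using * E by (auto simp: prob_update)
    next
      case False
      then have "E \<in> asg st X" "Dis [AVar X] [D] \<in> prob st" using frame * E by auto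
      then show ?thesis using inv * by (auto simp: invariant_def expanded_def prob_update)
    qed
  qed
  ultimately show ?thesis using A acyc by (simp add: invariant_def)
qed

section \<open>Preservation of the invariant by the rules\<close>

lemma invariant_mark_solved:
  assumes "invariant \<Gamma> st" "justified st e"
  shows "invariant \<Gamma> (mark_solved e st)"
  unfolding mark_solved_update
proof (rule invariant_update[OF assms(1)])
  show "justified (update e {} {} (asg st) st) e"
    using assms(2) by (rule justified_mono) (auto simp: prob_update)
qed (use assms(1) in \<open>auto simp: invariant_def\<close>)

text \<open>The atom just added to the assignment of \<open>X\<close> is itself the justification of
  the marked subsumption.\<close>

lemma invariant_extension:
  assumes inv: "invariant \<Gamma> st" and e: "Sub Cs D \<in> unsolved st" and X: "AVar X \<in> set Cs"
    and res: "extension_action (Sub Cs D) X D st = Next st'"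
  shows "invariant \<Gamma> st'"
proof -
  let ?A = "(asg st)(X := insert D (asg st X))"
  have "Sub Cs D \<in> universe \<Gamma>" "\<not> is_var D"
    using inv e by (auto simp: invariant_def unsolved_def)
  then have "D \<in> At_nv \<Gamma>" by (simp add: At_nv_def Sub_universe)
  moreover have "acyclic_asg ?A" and st': "st' = update (Sub Cs D) {X} {} ?A st"
    using res
    by (auto simp: extension_action_def Let_def expand_add_to_asg_update asg_add_to_asg
        simp del: fun_upd_apply split: if_splits)
  ultimately show ?thesis
    unfolding st' using inv X
    by (intro invariant_update) (auto simp: invariant_def assignment_def)
qed

lemma invariant_atomic:
  assumes inv: "invariant \<Gamma> st" and e: "Dis [C] [D] \<in> unsolved st"
    and nv: "\<not> is_var C" "\<not> is_var D"
    and res: "atomic_action (Dis [C] [D]) C D st = Next st'"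
  shows "invariant \<Gamma> st'"
proof (cases "\<exists>r C' D'. C = AEx r C' \<and> D = AEx r D' \<and>
    \<not> (ground (term_of C) \<and> ground (term_of D))")
  case True
  then obtain r C' D' where CD: "C = AEx r C'" "D = AEx r D'"
      "\<not> (ground (term_of C) \<and> ground (term_of D))" by blast
  have "[C] \<in> lhs_lists \<Gamma>" "D \<in> At \<Gamma>"
    using inv e by (auto simp: invariant_def unsolved_def Dis_universe)
  then have "C \<in> At \<Gamma>" "D \<in> At \<Gamma>" using lhs_lists_At by fastforce+
  then have At: "AName C' \<in> At \<Gamma>" "AName D' \<in> At \<Gamma>"
    using At_filler unfolding CD by fast+
  \<comment> \<open>If \<open>D'\<close> is a variable, the new dissubsumption is not of initially
    solved form, and there is nothing to expand.\<close>
  have st': "st' = update (Dis [C] [D]) {X. C' = Var X \<and> (\<forall>Y. D' \<noteq> Var Y)}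
      {Dis [AName C'] [AName D']} (asg st) st"
    using res CD(3) unfolding atomic_action_def CD(1,2)
    by (auto simp: expand_add_update)
  show ?thesis
    unfolding st'
    by (rule invariant_update[OF inv])
      (use At inv CD in \<open>auto simp: Dis_universe singleton_lhs_lists invariant_def prob_update is_var_def\<close>)
next
  case False
  have "st' = mark_solved (Dis [C] [D]) st \<and> justified st (Dis [C] [D])"
  proof (cases "ground (term_of C) \<and> ground (term_of D)")
    case True
    then show ?thesis
      using res nv
      by (auto simp: atomic_action_def solves_Dis_nonvar subst_ground split: if_splits)
  next
    case nonground: False
    \<comment> \<open>What remains is a constant against an existential restriction, or two
      restrictions with distinct roles; two constants would be ground.\<close>
    then have "\<not> inst \<sigma> C \<sqsubseteq>\<^sub>c inst \<sigma> D" for \<sigma>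
      using nv(1) nv(2) False
      by (elim nonvar_cases) (auto simp: subsumed_Name_iff subsumed_Ex_iff ground_def)
    moreover have "st' = mark_solved (Dis [C] [D]) st"
      using res nonground False unfolding atomic_action_def
      by (auto split: fatom.splits if_splits)
    ultimately show ?thesis using nv by (simp add: solves_Dis_nonvar)
  qed
  then show ?thesis using inv invariant_mark_solved by blast
qed

lemma invariant_eager_rule:
  assumes rule: "eager_rule st e (Next st')" and e: "e \<in> unsolved st" and inv: "invariant \<Gamma> st"
  shows "invariant \<Gamma> st'"
  using rule
proof cases
  case (ground_solving_sub Cs D)
  then have "st' = mark_solved e st" "conj_of Cs \<sqsubseteq>\<^sub>c term_of D" by (auto split: if_splits)
  then show ?thesis
    using inv ground_solving_sub by (auto intro!: invariant_mark_solved simp: solves.simps subst_ground)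
next
  case (ground_solving_dis Cs D)
  then have "st' = mark_solved e st" "\<not> conj_of Cs \<sqsubseteq>\<^sub>c term_of D" by (auto split: if_splits)
  then show ?thesis
    using inv ground_solving_dis by (auto intro!: invariant_mark_solved simp: solves.simps subst_ground)
next
  case (solving_sub Cs D)
  then show ?thesis
    using inv by (auto intro!: invariant_mark_solved simp: solves_Sub Conj_subsumed_member)
next
  case (eager_extension Cs D X)
  then show ?thesis using invariant_extension[OF inv, of Cs D X] e by simp
next
  case (left_decomposition Cs D)
  then have "Dis Cs [D] \<in> universe \<Gamma>" using inv e by (auto simp: invariant_def unsolved_def)
  then have "D \<in> At \<Gamma>" "set Cs \<subseteq> At \<Gamma>" using lhs_lists_At by (auto simp: Dis_universe)
  moreover have st': "st' = update e {X. AVar X \<in> set Cs} {Dis [C] [D] |C. C \<in> set Cs} (asg st) st"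
    using left_decomposition by (simp add: expand_add_update)
  ultimately show ?thesis
    unfolding st' using inv left_decomposition
    by (intro invariant_update)
      (auto simp: invariant_def Dis_universe singleton_lhs_lists prob_update)
next
  case (atomic_decomposition C D)
  then show ?thesis using invariant_atomic[OF inv, of C D] e by simp
qed

lemma invariant_nondet_rule:
  assumes rule: "nondet_rule \<Gamma> st e (Next st')" and e: "e \<in> unsolved st" and inv: "invariant \<Gamma> st"
  shows "invariant \<Gamma> st'"
  using rule
proof cases
  case (decomposition Cs s D C)
  then have "Sub Cs (AEx s D) \<in> universe \<Gamma>" using inv e by (auto simp: invariant_def unsolved_def)
  then have "AEx s D \<in> At \<Gamma>" "AEx s C \<in> At \<Gamma>"
    using lhs_lists_At decomposition by (auto simp: Sub_universe)
  then have "AName D \<in> At \<Gamma>" "AName C \<in> At \<Gamma>" using At_filler by fast+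
  moreover have st': "st' = update e {X. D = Var X} {Sub [AName C] (AName D)} (asg st) st"
    using decomposition by (simp add: expand_add_update)
  ultimately show ?thesis
    unfolding st' using inv decomposition
    by (intro invariant_update)
      (auto simp: invariant_def Sub_universe singleton_lhs_lists prob_update)
next
  case (extension Cs D X)
  then show ?thesis using invariant_extension[OF inv, of Cs D X] e by simp
next
  case (local_extension Cs X D st1)
  let ?A = "(asg st)(X := insert D (asg st X))"
  \<comment> \<open>As \<open>D\<close> is not a variable, \<open>Dis Cs [D]\<close> has initially
    solved form when \<open>Cs\<close> is a single variable, which must then be expanded
    too.\<close>
  have acyc: "acyclic_asg ?A"
    and st': "st' = update e ({X} \<union> {Y. Cs = [AVar Y]}) {Dis Cs [D]} ?A st"
    using local_extension
    by (auto simp: expand_add_to_asg_update asg_add_to_asg simp del: fun_upd_apply split: if_splits)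
  have "Dis Cs [AVar X] \<in> universe \<Gamma>"
    using inv e local_extension by (auto simp: invariant_def unsolved_def)
  then have "Dis Cs [D] \<in> universe \<Gamma>"
    using local_extension by (auto simp: Dis_universe At_nv_def)
  then show ?thesis
    unfolding st' using inv local_extension acyc
    by (intro invariant_update) (auto simp: invariant_def assignment_def prob_update)
qed

lemma invariant_step: "step \<Gamma> st (Next st') \<Longrightarrow> invariant \<Gamma> st \<Longrightarrow> invariant \<Gamma> st'"
  by (erule step.cases) (auto intro: invariant_eager_rule invariant_nondet_rule)

lemma run_success_invariant:
  assumes "run \<Gamma> st (Success \<sigma>)" "invariant \<Gamma> st"
  shows "\<exists>st'. invariant \<Gamma> st' \<and> unsolved st' = {} \<and> \<sigma> = sigma (asg st')"
  using assms
  by (induction st "Success \<sigma> :: ('a, 'b, 'c) result" rule: run.induct)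
    (auto intro: invariant_step)

text \<open>Marks are never withdrawn. This supplies the decreasing measure in the proof of
  \<open>completeness\<close>.\<close>

lemma solved_rule:
  "eager_rule st e (Next st') \<Longrightarrow> insert e (solved st) \<subseteq> solved st'"
  "nondet_rule \<Gamma> st e (Next st') \<Longrightarrow> insert e (solved st) \<subseteq> solved st'"
  by (auto simp: mark_solved_def expand_def add_constrs_def add_to_asg_def extension_action_def
      atomic_action_def Let_def elim!: eager_rule.cases nondet_rule.cases
      split: if_splits fatom.splits)


section \<open>Soundness\<close>

text \<open>Here and in the next lemma the order chosen by \<open>enum_set\<close> disappears; only
  the set \<open>S X\<close> matters for subsumption.\<close>

lemma subsumed_sigma_iff:
  assumes "finite \<Gamma>" "assignment \<Gamma> S" "acyclic_asg S"
  shows "C \<sqsubseteq>\<^sub>c sigma S X \<longleftrightarrow> (\<forall>E\<in>S X. C \<sqsubseteq>\<^sub>c inst (sigma S) E)"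
  using sigma_acyclic[OF assms, of X] by (simp add: subsumed_Conj_iff)

lemma sigma_subsumed_nonvar_iff:
  assumes "finite \<Gamma>" "assignment \<Gamma> S" "acyclic_asg S" "\<not> is_var D"
  shows "sigma S X \<sqsubseteq>\<^sub>c inst \<tau> D \<longleftrightarrow> (\<exists>E\<in>S X. inst (sigma S) E \<sqsubseteq>\<^sub>c inst \<tau> D)"
  using sigma_acyclic[OF assms(1-3), of X] assms(4) by (simp add: Conj_subsumed_nonvar)

text \<open>The weight strictly decreases from a solved constraint to the constraints that
  justify it.\<close>

fun weight :: "('v, 'c, 'r) subst \<Rightarrow> ('v, 'c, 'r) constr \<Rightarrow> nat" where
  "weight \<sigma> (Sub Cs D) = 2 * role_depth (inst \<sigma> D) + of_bool (is_var D)"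
| "weight \<sigma> (Dis Cs Ds) =
     8 * (role_depth (Conj (map (inst \<sigma>) Cs)) + role_depth (Conj (map (inst \<sigma>) Ds))) +
     4 * of_bool (\<exists>X. Ds = [AVar X]) + 2 * of_bool (length Cs \<noteq> 1) + of_bool (\<exists>X. Cs = [AVar X])"

text \<open>Induction along justifications. Replacing a variable by an atom assigned to it does not
  raise the role depth and clears a flag of \<open>weight\<close>. Left decomposition trades the
  flag worth 2 for at most the flag worth 1. Passing to fillers lowers the role depth, which
  outweighs any flags that get set.\<close>

lemma final_state_solved:
  assumes fin: "finite \<Gamma>" and inv: "invariant \<Gamma> st" and unsolved: "unsolved st = {}"
    and e: "e \<in> prob st"
  shows "solves (sigma (asg st)) e"
  using e
proof (induction e rule: measure_induct_rule[where f = "weight (sigma (asg st))"])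
  case (less e)
  define S where "S = asg st"
  define \<sigma> where "\<sigma> = sigma S"
  have S: "assignment \<Gamma> S" "acyclic_asg S" using inv by (auto simp: invariant_def S_def)
  note upper = subsumed_sigma_iff[OF fin S, folded \<sigma>_def]
  note lower = sigma_subsumed_nonvar_iff[OF fin S, folded \<sigma>_def]
  have member: "\<sigma> X \<sqsubseteq>\<^sub>c inst \<sigma> E" if "E \<in> S X" for E X
    using upper subsumed_refl that by blast
  have nonvar: "\<not> is_var E" if "E \<in> S X" for E X
    using S that by (auto simp: assignment_def At_nv_def)
  have depth: "role_depth (inst \<sigma> E) \<le> role_depth (\<sigma> X)" if "E \<in> S X" for E X
    using member[OF that] by (rule role_depth_antimono)
  have IH: "solves \<sigma> e'" if "e' \<in> prob st" "weight \<sigma> e' < weight \<sigma> e" for e'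
    using less.IH that by (simp add: \<sigma>_def S_def)
  have just: "justified st e"
    using inv unsolved less.prems by (auto simp: invariant_def unsolved_def)
  have exp: "expanded st" using inv by (simp add: invariant_def)
  have "solves \<sigma> e"
  proof (cases e)
    case (Sub Cs D)
    consider X where "D = AVar X" | "\<forall>\<tau>. solves \<tau> e" | X where "AVar X \<in> set Cs" "D \<in> S X"
      | s C D' where "D = AEx s D'" "AEx s C \<in> set Cs" "Sub [AName C] (AName D') \<in> prob st"
      using just unfolding Sub justified.simps S_def is_var_def by blast
    then show ?thesis
    proof cases
      case (1 X)
      have "solves \<sigma> (Sub Cs E)" if "E \<in> S X" for E
      proof (rule IH)
        show "Sub Cs E \<in> prob st"
          using exp that less.prems Sub 1 by (auto simp: expanded_def S_def)
        show "weight \<sigma> (Sub Cs E) < weight \<sigma> e"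
          using nonvar[OF that] depth[OF that] Sub 1 by (auto simp: is_var_def)
      qed
      then show ?thesis using Sub 1 by (simp add: solves_Sub upper)
    next
      case 2
      then show ?thesis by blast
    next
      case (3 X)
      then have "inst \<sigma> (AVar X) \<sqsubseteq>\<^sub>c inst \<sigma> D" using member by simp
      then have "\<exists>C\<in>set Cs. inst \<sigma> C \<sqsubseteq>\<^sub>c inst \<sigma> D" using 3(1) by blast
      then show ?thesis
        using nonvar[OF 3(2)] Sub by (simp add: solves_Sub_nonvar)
    next
      case (4 s C D')
      then have "solves \<sigma> (Sub [AName C] (AName D'))"
        using Sub by (intro IH) (auto simp: of_bool_def)
      then have "inst \<sigma> (AEx s C) \<sqsubseteq>\<^sub>c inst \<sigma> (AEx s D')"
        by (simp add: solves_Sub inst_Ex_subsumed_iff del: term_of.simps(2))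
      then have "\<exists>B\<in>set Cs. inst \<sigma> B \<sqsubseteq>\<^sub>c inst \<sigma> D" using 4(1,2) by blast
      then show ?thesis using 4(1) Sub by (simp add: solves_Sub_nonvar is_var_def)
    qed
  next
    case (Dis Cs Ds)
    consider "\<forall>\<tau>. solves \<tau> e" | X D where "Cs = [AVar X]" "Ds = [D]" "\<not> is_var D"
      | D where "Ds = [D]" "\<not> is_var D" "length Cs \<noteq> 1" "\<forall>C\<in>set Cs. Dis [C] [D] \<in> prob st"
      | r C D where "Cs = [AEx r C]" "Ds = [AEx r D]" "Dis [AName C] [AName D] \<in> prob st"
      | X D where "Ds = [AVar X]" "D \<in> S X" "Dis Cs [D] \<in> prob st"
      using just unfolding Dis justified.simps S_def by blast
    then show ?thesis
    proof cases
      case 1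
      then show ?thesis by blast
    next
      \<comment> \<open>\<open>D\<close> is not a variable, so \<open>\<sigma> X\<close> is subsumed
        by its instance only if one conjunct of \<open>\<sigma> X\<close> is;
        \<open>expanded\<close> provides the dissubsumption for each conjunct.\<close>
      case (2 X D)
      have "solves \<sigma> (Dis [E] [D])" if "E \<in> S X" for E
      proof (rule IH)
        show "Dis [E] [D] \<in> prob st"
          using exp that less.prems Dis 2 by (auto simp: expanded_def S_def)
        show "weight \<sigma> (Dis [E] [D]) < weight \<sigma> e"
          using nonvar[OF that] depth[OF that] Dis 2 by (auto simp: is_var_def)
      qed
      then show ?thesis using Dis 2 by (simp add: solves_Dis_nonvar lower)
    next
      case (3 D)
      have "solves \<sigma> (Dis [C] [D])" if "C \<in> set Cs" for C
      proof (rule IH)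
        show "Dis [C] [D] \<in> prob st" using 3 that by blast
        have "role_depth (inst \<sigma> C) \<le> role_depth (Conj (map (inst \<sigma>) Cs))"
          using that by (intro role_depth_antimono Conj_subsumed_member) simp
        then show "weight \<sigma> (Dis [C] [D]) < weight \<sigma> e"
          using Dis 3 by (auto simp: of_bool_def)
      qed
      then show ?thesis using Dis 3 by (simp add: solves_Dis_nonvar)
    next
      case (4 r C D)
      then have "solves \<sigma> (Dis [AName C] [AName D])"
        using Dis by (intro IH) (auto simp: of_bool_def)
      then have "\<not> inst \<sigma> (AEx r C) \<sqsubseteq>\<^sub>c inst \<sigma> (AEx r D)"
        by (simp add: solves_Dis1 inst_Ex_subsumed_iff del: term_of.simps(2))
      then show ?thesis using 4 Dis by (simp add: solves_Dis1)
    next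
      \<comment> \<open>One conjunct of \<open>\<sigma> X\<close> that does not subsume the
        left-hand side is enough.\<close>
      case (5 X D)
      have "solves \<sigma> (Dis Cs [D])"
        using 5 Dis nonvar[OF 5(2)] depth[OF 5(2)]
        by (intro IH) (auto simp: is_var_def)
      then show ?thesis using 5 Dis by (auto simp: solves_Dis1 upper)
    qed
  qed
  then show ?case by (simp add: \<sigma>_def S_def)
qed

section \<open>The signature of the computed substitution\<close>

definition over :: "('v, 'c) cname set \<Rightarrow> 'r set \<Rightarrow> (('v, 'c) cname, 'r) concept \<Rightarrow> bool" where
  "over NC NR C \<longleftrightarrow> ground C \<and> cnames C \<subseteq> NC \<and> roles C \<subseteq> NR"

lemma over_Conj: "over NC NR (Conj Cs) \<longleftrightarrow> (\<forall>C\<in>set Cs. over NC NR C)"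
  by (induction Cs rule: Conj.induct) (auto simp: over_def ground_def)

lemma over_inst:
  assumes "cnames (term_of D) \<subseteq> NC" "roles (term_of D) \<subseteq> NR"
    "\<And>Y. Var Y \<in> cnames (term_of D) \<Longrightarrow> over NC NR (\<sigma> Y)"
  shows "over NC NR (inst \<sigma> D)"
proof -
  have "over NC NR (subst \<sigma> (Name A))" if "cnames (Name A) \<subseteq> NC"
      "\<And>Y. Var Y \<in> cnames (Name A) \<Longrightarrow> over NC NR (\<sigma> Y)" for A
    using that by (cases A) (auto simp: over_def ground_def)
  then show ?thesis using assms by (cases D) (auto simp: over_def ground_def)
qed

lemma over_sigma:
  assumes "flat_problem NC NR \<Gamma>" "assignment \<Gamma> S"
  shows "over NC NR (sigma S X)"
  using assms(2)
proof (induction S X rule: sigma.induct)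
  case (1 S X)
  have "over NC NR (inst (sigma S) D)" if "wf ((dep S)\<inverse>)" "D \<in> set (enum_set (S X))" for D
  proof (rule over_inst)
    have "D \<in> At \<Gamma>" using that 1(2) enum_set_subset by (fastforce simp: assignment_def At_nv_def)
    then show "cnames (term_of D) \<subseteq> NC" "roles (term_of D) \<subseteq> NR"
      using assms(1) by (auto simp: flat_problem_def)
  qed (use 1 that in blast)
  \<comment> \<open>The final \<open>simp\<close> treats \<open>Top\<close>, the default value of
    \<open>sigma\<close> in the branch without well-foundedness.\<close>
  then show ?case
    by (subst sigma.simps) (auto simp: over_Conj, simp add: over_def ground_def)
qed

theorem soundness:
  assumes flat: "flat_problem NC NR \<Gamma>" and run: "run \<Gamma> (init \<Gamma>) (Success \<sigma>)"
    and single: "\<forall>Cs Ds. Dis Cs Ds \<in> \<Gamma> \<longrightarrow> length Ds = 1"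
  shows "local_solution NC NR \<Gamma> \<sigma>"
proof -
  obtain st where st: "invariant \<Gamma> st" "unsolved st = {}" "\<sigma> = sigma (asg st)"
    using run_success_invariant[OF run invariant_init[OF single]] by blast
  have fin: "finite \<Gamma>" using flat by (simp add: flat_problem_def)
  have asg: "assignment \<Gamma> (asg st)" "acyclic_asg (asg st)" "\<Gamma> \<subseteq> prob st"
    using st(1) by (auto simp: invariant_def)
  then have "\<forall>e\<in>\<Gamma>. solves \<sigma> e" using final_state_solved[OF fin st(1,2)] st(3) by blast
  moreover have "over NC NR (\<sigma> X)" for X using over_sigma[OF flat asg(1)] st(3) by blast
  ultimately show ?thesis
    using asg st(3) by (auto simp: local_solution_def solution_def over_def)
qed


section \<open>Completeness\<close>

text \<open>The assignment of the run is compared with \<gamma> only semantically: it need not be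
  contained in the assignment that induces \<gamma>.\<close>

definition guided :: "('v, 'c, 'r) subst \<Rightarrow> ('v, 'c, 'r) state \<Rightarrow> bool" where
  "guided \<gamma> st \<longleftrightarrow> (\<forall>e\<in>prob st. solves \<gamma> e) \<and> (\<forall>X. \<forall>D\<in>asg st X. \<gamma> X \<sqsubseteq>\<^sub>c inst \<gamma> D)"

text \<open>A dependency of \<open>X\<close> on \<open>Y\<close> stems from an atom
  \<open>AEx r (Var Y)\<close>, so the role depth of \<open>\<gamma> X\<close> exceeds that of
  \<open>\<gamma> Y\<close>.\<close>

lemma acyclic_if_subsumed:
  assumes "\<And>X D. D \<in> A X \<Longrightarrow> \<not> is_var D \<and> \<gamma> X \<sqsubseteq>\<^sub>c inst \<gamma> D"
  shows "acyclic_asg A"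
proof -
  have "dep A \<subseteq> (inv_image less_than (\<lambda>X. role_depth (\<gamma> X)))\<inverse>"
  proof (clarsimp simp: dep_def)
    fix X Y D
    assume D: "D \<in> A X" "Var Y \<in> cnames (term_of D)"
    then obtain r where "D = AEx r (Var Y)"
      using assms[of D X] by (auto elim!: nonvar_cases)
    then show "role_depth (\<gamma> Y) < role_depth (\<gamma> X)"
      using assms[OF D(1)] role_depth_antimono by fastforce
  qed
  moreover have "acyclic ((inv_image less_than (\<lambda>X. role_depth (\<gamma> X)))\<inverse>)"
    by (simp only: acyclic_converse) (intro wf_acyclic wf_inv_image wf_less_than)
  ultimately show ?thesis by (rule acyclic_subset[rotated])
qed

text \<open>Expansion is sound for \<gamma> by transitivity: it replaces \<open>X\<close> by atoms
  whose instances lie above \<open>\<gamma> X\<close>.\<close>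

lemma guided_update:
  assumes g: "guided \<gamma> st" and N: "\<And>e. e \<in> N \<Longrightarrow> solves \<gamma> e"
    and A: "\<And>X D. D \<in> A X \<Longrightarrow> \<gamma> X \<sqsubseteq>\<^sub>c inst \<gamma> D"
  shows "guided \<gamma> (update e Xs N A st)"
proof -
  have old: "solves \<gamma> e'" if "e' \<in> prob st \<union> N" for e'
    using that g N by (auto simp: guided_def)
  have "solves \<gamma> (Sub Cs E)" if "Sub Cs (AVar X) \<in> prob st \<union> N" "E \<in> A X" for Cs X E
    using old[OF that(1)] A[OF that(2)] subsumed_trans by (auto simp: solves_Sub)
  moreover have "solves \<gamma> (Dis [E] [D])"
    if "Dis [AVar X] [D] \<in> prob st \<union> N" "E \<in> A X" for X D E
    using old[OF that(1)] A[OF that(2)] subsumed_trans by (auto simp: solves_Dis1)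
  ultimately show ?thesis using old A unfolding guided_def prob_update asg_update by blast
qed

lemma guided_mark_solved: "guided \<gamma> st \<Longrightarrow> guided \<gamma> (mark_solved e st)"
  by (simp add: guided_def mark_solved_def)

lemma guided_add_to_asg:
  assumes inv: "invariant \<Gamma> st" and g: "guided \<gamma> st" and D: "\<not> is_var D" "\<gamma> X \<sqsubseteq>\<^sub>c inst \<gamma> D"
    and N: "\<And>e. e \<in> N \<Longrightarrow> solves \<gamma> e"
  shows "acyclic_asg (asg (add_to_asg X D st))"
    and "guided \<gamma> (mark_solved e (expand Xs (add_constrs N (add_to_asg X D st))))"
    and "guided \<gamma> (mark_solved e (expand Xs (add_to_asg X D st)))"
proof -
  have *: "\<not> is_var E \<and> \<gamma> Y \<sqsubseteq>\<^sub>c inst \<gamma> E" if "E \<in> ((asg st)(X := insert D (asg st X))) Y" for E Y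
    using inv g D that
    by (auto simp: invariant_def assignment_def At_nv_def guided_def split: if_splits)
  show "acyclic_asg (asg (add_to_asg X D st))"
    unfolding asg_add_to_asg using * by (rule acyclic_if_subsumed)
  show "guided \<gamma> (mark_solved e (expand Xs (add_constrs N (add_to_asg X D st))))"
    unfolding expand_add_to_asg_update by (rule guided_update[OF g N]) (use * in auto)
  show "guided \<gamma> (mark_solved e (expand Xs (add_to_asg X D st)))"
    unfolding expand_add_to_asg_update by (rule guided_update[OF g]) (use * in auto)
qed

section \<open>Rule applications guided by a local solution\<close>

lemma guided_extension:
  assumes "invariant \<Gamma> st" "guided \<gamma> st" "Sub Cs D \<in> unsolved st" "\<gamma> X \<sqsubseteq>\<^sub>c inst \<gamma> D"
  shows "\<exists>st'. extension_action (Sub Cs D) X D st = Next st' \<and> guided \<gamma> st'"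
proof -
  have "\<not> is_var D" using assms by (auto simp: invariant_def unsolved_def)
  then show ?thesis
    using guided_add_to_asg[OF assms(1,2) _ assms(4), of "{}"]
    by (simp add: extension_action_def Let_def)
qed

text \<open>Substitution leaves ground atoms unchanged, so a failing ground test would contradict
  that \<gamma> solves the constraint. For equal roles, monotonicity of \<open>Ex r\<close> passes
  the dissubsumption to the fillers.\<close>

lemma guided_atomic:
  assumes g: "guided \<gamma> st" and e: "Dis [C] [D] \<in> unsolved st"
    and nv: "\<not> is_var C" "\<not> is_var D"
  shows "\<exists>st'. atomic_action (Dis [C] [D]) C D st = Next st' \<and> guided \<gamma> st'"
proof -
  have ns: "\<not> inst \<gamma> C \<sqsubseteq>\<^sub>c inst \<gamma> D"
    using g e by (auto simp: guided_def unsolved_def solves_Dis1)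
  show ?thesis
  proof (cases "\<exists>r C' D'. C = AEx r C' \<and> D = AEx r D' \<and>
    \<not> (ground (term_of C) \<and> ground (term_of D))")
    case True
    then obtain r C' D' where CD: "C = AEx r C'" "D = AEx r D'"
        "\<not> (ground (term_of C) \<and> ground (term_of D))" by blast
    have "solves \<gamma> (Dis [AName C'] [AName D'])"
      using ns subsumed_ExI unfolding CD solves_Dis1 by fastforce
    then have "guided \<gamma> (update (Dis [C] [D]) {X. C' = Var X \<and> (\<forall>Y. D' \<noteq> Var Y)}
        {Dis [AName C'] [AName D']} (asg st) st)"
      using g by (intro guided_update) (auto simp: guided_def)
    then show ?thesis
      using CD(3) unfolding atomic_action_def CD(1,2) by (auto simp: expand_add_update)
  next
    case False
    have "\<not> (ground (term_of C) \<and> ground (term_of D) \<and> term_of C \<sqsubseteq>\<^sub>c term_of D)"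
      using ns by (auto simp: subst_ground)
    then have "atomic_action (Dis [C] [D]) C D st = Next (mark_solved (Dis [C] [D]) st)"
      using False by (auto simp: atomic_action_def split: fatom.splits)
    then show ?thesis using guided_mark_solved[OF g] by simp
  qed
qed

text \<open>Eager rules cannot be postponed, so every applicable one has to be safe for \<gamma>,
  not just a suitable one.\<close>

lemma guided_eager_rule:
  assumes rule: "eager_rule st e res" and e: "e \<in> unsolved st"
    and inv: "invariant \<Gamma> st" and g: "guided \<gamma> st"
  shows "\<exists>st'. res = Next st' \<and> guided \<gamma> st'"
proof -
  have sol: "solves \<gamma> e" and e_univ: "e \<in> universe \<Gamma>"
    using g e inv by (auto simp: guided_def unsolved_def invariant_def)
  have asg: "\<gamma> X \<sqsubseteq>\<^sub>c inst \<gamma> D" if "D \<in> asg st X" for X D using g that by (simp add: guided_def)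
  show ?thesis
    using rule
  proof cases
    case (ground_solving_sub Cs D)
    then show ?thesis using sol guided_mark_solved[OF g] by (simp add: solves.simps subst_ground)
  next
    case (ground_solving_dis Cs D)
    then show ?thesis using sol guided_mark_solved[OF g] by (simp add: solves.simps subst_ground)
  next
    case (solving_sub Cs D)
    then show ?thesis using guided_mark_solved[OF g] by simp
  next
    case (solving_dis Cs D)
    have "inst \<gamma> (AVar X) \<sqsubseteq>\<^sub>c inst \<gamma> D" if "D \<in> asg st X" for X using asg[OF that] by simp
    then obtain C where "C \<in> set Cs" "inst \<gamma> C \<sqsubseteq>\<^sub>c inst \<gamma> D"
      using solving_dis(3) subsumed_refl by blast
    then have "Conj (map (inst \<gamma>) Cs) \<sqsubseteq>\<^sub>c inst \<gamma> D"
      by (intro subsumed_trans[OF Conj_subsumed_member]) auto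
    then show ?thesis using sol solving_dis by (simp add: solves_Dis1)
  next
    case (eager_extension Cs D X)
    \<comment> \<open>All conjuncts other than \<open>X\<close> are already assigned to
      \<open>X\<close>, so \<open>\<gamma> X\<close> lies below the whole left-hand side and hence
      below \<open>D\<close>.\<close>
    have "\<gamma> X \<sqsubseteq>\<^sub>c inst \<gamma> C" if "C \<in> set Cs" for C
      using eager_extension that asg subsumed_refl by (cases "C = AVar X") auto
    then have "\<gamma> X \<sqsubseteq>\<^sub>c Conj (map (inst \<gamma>) Cs)" by (simp add: subsumed_Conj_iff)
    then have "\<gamma> X \<sqsubseteq>\<^sub>c inst \<gamma> D"
      using sol eager_extension subsumed_trans by (auto simp: solves_Sub)
    then show ?thesis using guided_extension[OF inv g] e eager_extension by blast
  next
    case (top_solving Cs)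
    then show ?thesis using e_univ by (simp add: Dis_universe)
  next
    case (left_decomposition Cs D)
    then have "solves \<gamma> (Dis [C] [D])" if "C \<in> set Cs" for C
      using sol that by (simp add: solves_Dis_nonvar)
    then have "guided \<gamma> (update e {X. AVar X \<in> set Cs} {Dis [C] [D] |C. C \<in> set Cs} (asg st) st)"
      using asg by (intro guided_update[OF g]) auto
    then show ?thesis using left_decomposition by (simp add: expand_add_update)
  next
    case (atomic_decomposition C D)
    then show ?thesis using guided_atomic[OF g] e by blast
  qed
qed

text \<open>For a subsumption, a conjunct whose instance lies below that of \<open>D\<close>
  dictates the choice: Extension if it is a variable, Decomposition otherwise. For a dissubsumption,
  the absence of eager rules leaves only a variable on the right, hence Local Extension.\<close>

lemma guided_nondet_rule:
  assumes fin: "finite \<Gamma>" and S: "assignment \<Gamma> S" "acyclic_asg S" and \<gamma>: "\<gamma> = sigma S"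
    and inv: "invariant \<Gamma> st" and g: "guided \<gamma> st" and e: "e \<in> unsolved st"
    and no_eager: "\<And>res. \<not> eager_rule st e res"
  shows "\<exists>st'. nondet_rule \<Gamma> st e (Next st') \<and> guided \<gamma> st'"
proof -
  have sol: "solves \<gamma> e" and e_univ: "e \<in> universe \<Gamma>" and not_init: "\<not> initially_solved e"
    using g e inv by (auto simp: guided_def unsolved_def invariant_def)
  have asg: "\<gamma> X \<sqsubseteq>\<^sub>c inst \<gamma> D" if "D \<in> asg st X" for X D using g that by (simp add: guided_def)
  show ?thesis
  proof (cases e)
    case (Sub Cs D)
    then have D: "\<not> is_var D" using not_init by simp
    then obtain C where C: "C \<in> set Cs" "inst \<gamma> C \<sqsubseteq>\<^sub>c inst \<gamma> D"
      using sol Sub by (auto simp: solves_Sub_nonvar)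
    \<comment> \<open>This rules out a pair of equal constants below, leaving two existential
      restrictions.\<close>
    have "C \<noteq> D" using no_eager eager_rule.solving_sub[OF Sub] C by blast
    consider X where "C = AVar X" | "\<not> is_var C" by (auto simp: is_var_def)
    then show ?thesis
    proof cases
      case (1 X)
      then obtain st' where "extension_action e X D st = Next st'" "guided \<gamma> st'"
        using guided_extension[OF inv g, of Cs D X] e Sub C by auto
      then show ?thesis using nondet_rule.extension[of e Cs D X \<Gamma> st] Sub 1 C by auto
    next
      case 2
      then obtain s C' D' where CD: "C = AEx s C'" "D = AEx s D'"
        using D C(2) \<open>C \<noteq> D\<close>
        by (elim nonvar_cases) (auto simp: subsumed_Name_iff subsumed_Ex_iff)
      have "solves \<gamma> (Sub [AName C'] (AName D'))"
        using C(2) unfolding CD inst_Ex_subsumed_iff solves_Sub by simp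
      then have "guided \<gamma> (update e {X. D' = Var X} {Sub [AName C'] (AName D')} (asg st) st)"
        using asg by (intro guided_update[OF g]) auto
      then show ?thesis
        using nondet_rule.decomposition[of e Cs s D' C' \<Gamma> st] Sub CD C(1)
        by (auto simp: expand_add_update)
    qed
  next
    case (Dis Cs Ds)
    then obtain D where Ds: "Ds = [D]" using e_univ by (auto simp: Dis_universe)
    have "is_var D"
    proof (rule ccontr)
      assume D: "\<not> is_var D"
      show False
      proof (cases "length Cs = 1")
        case True
        then obtain C where Cs: "Cs = [C]" by (metis One_nat_def length_0_conv length_Suc_conv)
        then have "\<not> is_var C" using not_init Dis Ds D by (auto simp: is_var_def)
        then show False using no_eager eager_rule.atomic_decomposition Dis Ds Cs D by blast
      next
        case False
        then show False using no_eager eager_rule.left_decomposition Dis Ds D by blast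
      qed
    qed
    then obtain X where D: "D = AVar X" by (auto simp: is_var_def)
    \<comment> \<open>Locality is used here: \<open>\<gamma> X\<close> is the conjunction of the
      instances of atoms in \<open>S X\<close>, so one of them already fails to subsume the
      left-hand side.\<close>
    obtain E where E: "E \<in> S X" "\<not> Conj (map (inst \<gamma>) Cs) \<sqsubseteq>\<^sub>c inst \<gamma> E"
      using sol subsumed_sigma_iff[OF fin S] by (auto simp: Dis Ds D solves_Dis1 \<gamma>)
    have E_nv: "E \<in> At_nv \<Gamma>" using E S by (auto simp: assignment_def)
    have "\<gamma> X \<sqsubseteq>\<^sub>c inst \<gamma> E"
      using E(1) subsumed_sigma_iff[OF fin S, of "sigma S X" X] by (simp add: \<gamma> subsumed_refl)
    note ext = guided_add_to_asg[OF inv g _ this, of "{Dis Cs [E]}"]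
    show ?thesis
      using nondet_rule.local_extension[of e Cs X E \<Gamma> "add_to_asg X E st" st] Dis Ds D E_nv
        ext(1) ext(2)[of e "{X} \<union> {Y. Cs = [AVar Y]}"] E(2)
      by (auto simp: At_nv_def solves_Dis1)
  qed
qed

text \<open>Induction on the number of constraints in the finite universe not yet marked; each
  guided step marks one more.\<close>

theorem completeness:
  assumes fin: "finite \<Gamma>" and S: "assignment \<Gamma> S" "acyclic_asg S"
    and "invariant \<Gamma> st" "guided (sigma S) st"
  shows "\<exists>\<sigma>. run \<Gamma> st (Success \<sigma>)"
  using assms(4,5)
proof (induction "card (universe \<Gamma> - solved st)" arbitrary: st rule: less_induct)
  case less
  note inv = less.prems(1) and g = less.prems(2)
  show ?case
  proof (cases "unsolved st = {}")
    case True
    then show ?thesis using run.finished by blast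
  next
    case False
    have "\<exists>st' e. step \<Gamma> st (Next st') \<and> guided (sigma S) st' \<and> e \<in> unsolved st \<and>
      insert e (solved st) \<subseteq> solved st'"
    proof (cases "\<exists>e\<in>unsolved st. \<exists>res. eager_rule st e res")
      case True
      then obtain e res where e: "e \<in> unsolved st" "eager_rule st e res" by blast
      then obtain st' where "res = Next st'" "guided (sigma S) st'"
        using guided_eager_rule[OF _ _ inv g] by blast
      then show ?thesis using e step.eager solved_rule(1) by blast
    next
      case no_eager: False
      obtain e where e: "e \<in> unsolved st" using False by blast
      then obtain st' where "nondet_rule \<Gamma> st e (Next st')" "guided (sigma S) st'"
        using guided_nondet_rule[OF fin S refl inv g e] no_eager by blast
      then show ?thesis using e step.nondet[OF no_eager] solved_rule(2) by blast
    qed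
    then obtain st' e where st': "step \<Gamma> st (Next st')" "guided (sigma S) st'"
      and e: "e \<in> unsolved st" "insert e (solved st) \<subseteq> solved st'"
      by blast
    have "e \<in> universe \<Gamma> - solved st" using e(1) inv by (auto simp: unsolved_def invariant_def)
    then have "universe \<Gamma> - solved st' \<subset> universe \<Gamma> - solved st" using e(2) by blast
    then have "card (universe \<Gamma> - solved st') < card (universe \<Gamma> - solved st)"
      using finite_universe[OF fin] by (intro psubset_card_mono) auto
    then obtain \<sigma> where "run \<Gamma> st' (Success \<sigma>)"
      using less.hyps invariant_step[OF st'(1) inv] st'(2) by blast
    then show ?thesis using run.continue[OF st'(1)] by blast
  qed
qed

theorem theorem5p8:
  fixes \<Gamma>0 :: "('v, 'c, 'r) constr set"
    and NC :: "('v, 'c) cname set" and NR :: "'r set"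
  assumes "finite NC" and "finite NR"
    and "flat_problem NC NR \<Gamma>0"
    and "\<forall>Cs Ds. Dis Cs Ds \<in> \<Gamma>0 \<longrightarrow> length Ds = 1"
  shows "(\<exists>\<sigma>. local_solution NC NR \<Gamma>0 \<sigma>) \<longleftrightarrow> successful_run \<Gamma>0"
proof
  assume "\<exists>\<sigma>. local_solution NC NR \<Gamma>0 \<sigma>"
  then obtain S where S: "assignment \<Gamma>0 S" "acyclic_asg S" "\<forall>e\<in>\<Gamma>0. solves (sigma S) e"
    by (auto simp: local_solution_def solution_def)
  \<comment> \<open>The initial assignment is empty, so only the constraints of the problem have to
    be solved.\<close>
  then have "guided (sigma S) (init \<Gamma>0)" by (simp add: guided_def init_def)
  then show "successful_run \<Gamma>0"
    using completeness[OF _ S(1,2) invariant_init[OF assms(4)]] assms(3)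
    by (simp add: successful_run_def flat_problem_def)
next
  assume "successful_run \<Gamma>0"
  then show "\<exists>\<sigma>. local_solution NC NR \<Gamma>0 \<sigma>"
    using soundness[OF assms(3) _ assms(4)] by (auto simp: successful_run_def)
qed

end
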